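(* Let $p\ge 2$ be an integer, let $\zeta\in\mathbb C$ be a primitive $p$-th root of unity, and let $\mathfrak u,\mathfrak v\in M_p(\mathbb C)$ be the Weyl unitary matrices. If $u$ and $v$ are two $d\times d$ complex unitary matrices such that $u^p=v^p=1_d$ and $uv=\zeta vu$, then $(u,v)$ is completely order equivalent to $(\mathfrak u,\mathfrak v)$, that is, $(u,v)\simeq_{\rm ord}(\mathfrak u,\mathfrak v)$.
   Context: $M_n(\mathbb C)$ is the algebra of complex $n\times n$ matrices with identity $1_n$. The Weyl unitary matrices (with respect to $p$ and $\zeta$) are $\mathfrak u=\mathrm{diag}(1,\zeta,\zeta^2,\dots,\zeta^{p-1})$ and the cyclic shift $\mathfrak v$, whose $(1,p)$-entry and $(k,k-1)$-entries ($2\le k\le p$) are $1$ and whose other entries are $0$. For a $g$-tuple $x=(x_1,\dots,x_g)$ of complex $d\times d$ matrices, the operator system of $x$ is $\mathcal O_x=\mathrm{Span}_{\mathbb C}\{1_d,x_k,x_k^*\mid k=1,\dots,g\}$. If $x$ is a $g$-tuple in $M_{d_1}(\mathbb C)$ and $y$ is a $g$-tuple in $M_{d_2}(\mathbb C)$ (with $d_1,d_2$ possibly different), then $x\simeq_{\rm ord}y$ ($x$ and $y$ are completely order equivalent) means that there is a linear isomorphism $\phi:\mathcal O_x\to\mathcal O_y$ such that $\phi$ and $\phi^{-1}$ are unital completely positive and $\phi(x_k)=y_k$ for each $k=1,\dots,g$. *)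

theory Defs
  imports
    "Jordan_Normal_Form.Schur_Decomposition"
    "Jordan_Normal_Form.VS_Connect"
begin

definition primitive_root_of_unity :: "nat \<Rightarrow> complex \<Rightarrow> bool" where
  "primitive_root_of_unity p \<zeta> \<longleftrightarrow> 0 < p \<and> \<zeta> ^ p = 1 \<and> (\<forall>k. 0 < k \<and> k < p \<longrightarrow> \<zeta> ^ k \<noteq> 1)"

definition unitary_matrix :: "nat \<Rightarrow> complex mat \<Rightarrow> bool" where
  "unitary_matrix d u \<longleftrightarrow>
     u \<in> carrier_mat d d \<and> mat_adjoint u * u = 1\<^sub>m d \<and> u * mat_adjoint u = 1\<^sub>m d"

text \<open>Matrix indices start at 0, so the row and column numbers are those of the usual
  description of the Weyl unitaries lowered by one.\<close>

definition weyl_u :: "nat \<Rightarrow> complex \<Rightarrow> complex mat" where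
  "weyl_u p \<zeta> = mat_diag p (\<lambda>i. \<zeta> ^ i)"

definition weyl_v :: "nat \<Rightarrow> complex mat" where
  "weyl_v p = mat p p (\<lambda>(i, j). if (i = 0 \<and> j = p - 1) \<or> i = Suc j then 1 else 0)"

text \<open>The order on the complex numbers is the one of \<^theory>\<open>HOL-Library.Complex_Order\<close>:
  the inequality below says that the inner product is real and nonnegative. Since
  the scalars are complex, such a matrix is automatically Hermitian.\<close>

definition pos_semidef :: "nat \<Rightarrow> complex mat \<Rightarrow> bool" where
  "pos_semidef n A \<longleftrightarrow> A \<in> carrier_mat n n \<and> (\<forall>w \<in> carrier_vec n. 0 \<le> (A *\<^sub>v w) \<bullet>c w)"

text \<open>The operator system of a tuple (a list) of d-by-d matrices, as a linear subspace of
  the space of all d-by-d matrices.\<close>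

definition op_system :: "nat \<Rightarrow> complex mat list \<Rightarrow> complex mat set" where
  "op_system d xs =
     LinearCombinations.module.span class_ring (module_mat TYPE(complex) d d)
       ({1\<^sub>m d} \<union> set xs \<union> mat_adjoint ` set xs)"

definition op_system_space :: "nat \<Rightarrow> complex mat list \<Rightarrow> (complex, complex mat) module" where
  "op_system_space d xs = (module_mat TYPE(complex) d d)\<lparr>carrier := op_system d xs\<rparr>"

text \<open>The identification of matrices over the d-by-d complex matrices with complex matrices
  of d times the size: each entry becomes a d-by-d block.\<close>

definition flatten_mat :: "nat \<Rightarrow> complex mat mat \<Rightarrow> complex mat" where
  "flatten_mat d X = mat (dim_row X * d) (dim_col X * d)
     (\<lambda>(i, j). (X $$ (i div d, j div d)) $$ (i mod d, j mod d))"

text \<open>Complete positivity of a map \<open>\<phi>\<close> defined on a space S of \<open>d1\<close>-by-\<open>d1\<close> matrices, with values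
  in the \<open>d2\<close>-by-\<open>d2\<close> matrices: every amplification of \<open>\<phi>\<close> to the n-by-n matrices over S
  (apply \<open>\<phi>\<close> to each entry) preserves positivity.\<close>

definition completely_positive ::
  "nat \<Rightarrow> nat \<Rightarrow> complex mat set \<Rightarrow> (complex mat \<Rightarrow> complex mat) \<Rightarrow> bool" where
  "completely_positive d1 d2 S \<phi> \<longleftrightarrow>
     (\<forall>n. \<forall>X \<in> carrier_mat n n. elements_mat X \<subseteq> S \<longrightarrow> pos_semidef (n * d1) (flatten_mat d1 X)
        \<longrightarrow> pos_semidef (n * d2) (flatten_mat d2 (map_mat \<phi> X)))"

definition unital_completely_positive ::
  "nat \<Rightarrow> nat \<Rightarrow> complex mat set \<Rightarrow> (complex mat \<Rightarrow> complex mat) \<Rightarrow> bool" where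
  "unital_completely_positive d1 d2 S \<phi> \<longleftrightarrow>
     \<phi> (1\<^sub>m d1) = 1\<^sub>m d2 \<and> completely_positive d1 d2 S \<phi>"

definition complete_order_equivalent ::
  "nat \<Rightarrow> complex mat list \<Rightarrow> nat \<Rightarrow> complex mat list \<Rightarrow> bool" where
  "complete_order_equivalent d1 xs d2 ys \<longleftrightarrow>
     length xs = length ys \<and>
     (\<exists>\<phi> \<in> LinearCombinations.module_hom class_ring (op_system_space d1 xs) (op_system_space d2 ys).
        bij_betw \<phi> (op_system d1 xs) (op_system d2 ys) \<and>
        unital_completely_positive d1 d2 (op_system d1 xs) \<phi> \<and>
        unital_completely_positive d2 d1 (op_system d2 ys) (inv_into (op_system d1 xs) \<phi>) \<and>
        (\<forall>k < length xs. \<phi> (xs ! k) = ys ! k))"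

end

(* Let P be the projection onto the fixed space of u, P = (1/p) (1 + u + ... + u^(p-1)), and put
   Q_s = v^s P for s < p. The relations give Q_s^* Q_t = delta_st P, sum_s Q_s Q_s^* = 1,
   u Q_s = zeta^s Q_s and v Q_s = Q_(s+1 mod p), so the Q_i Q_j^* are matrix units in which u and v
   have the matrices of the Weyl unitaries. Hence the maps
     Y |-> sum_ij Y_ij Q_i Q_j^*   and   A |-> (tr (Q_i^* A Q_j) / tr P)_ij
   exchange 1, u, v with 1 and the Weyl unitaries. Both are of the form sum_r K_r^* Y K_r on the full
   matrix algebras, hence completely positive, and so restrict to mutually inverse unital completely
   positive maps between the operator systems. *)

theory Submission
  imports Defs
begin

section \<open>Adjoints of complex matrices\<close>

lemma dim_mat_adjoint [simp]:
  "dim_row (mat_adjoint A) = dim_col A" "dim_col (mat_adjoint A) = dim_row A"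
  by (auto simp: mat_adjoint_def mat_of_rows_def)

lemma mat_adjoint_carrier [simp]:
  "A \<in> carrier_mat m n \<Longrightarrow> mat_adjoint A \<in> carrier_mat n m"
  by auto

lemma index_mat_adjoint [simp]:
  "i < dim_col A \<Longrightarrow> j < dim_row A \<Longrightarrow> mat_adjoint A $$ (i, j) = conjugate (A $$ (j, i))"
  by (auto simp: mat_adjoint_def mat_of_rows_def)

lemma mat_adjoint_adjoint [simp]: "mat_adjoint (mat_adjoint A) = A"
  by (rule eq_matI) auto

lemma mat_adjoint_one [simp]: "mat_adjoint (1\<^sub>m n :: complex mat) = 1\<^sub>m n"
  by (rule eq_matI) auto

lemma mat_adjoint_smult: "mat_adjoint (c \<cdot>\<^sub>m A) = conjugate c \<cdot>\<^sub>m mat_adjoint A"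
  by (rule eq_matI) (auto simp: conjugate_dist_mul)

lemma index_mult_mat_sum:
  "i < dim_row A \<Longrightarrow> j < dim_col B \<Longrightarrow> dim_col A = dim_row B \<Longrightarrow>
    (A * B) $$ (i, j) = (\<Sum>k<dim_row B. A $$ (i, k) * B $$ (k, j))"
  by (simp add: scalar_prod_def atLeast0LessThan)

lemma mat_adjoint_mult:
  fixes A B :: "complex mat"
  assumes "A \<in> carrier_mat m n" "B \<in> carrier_mat n k"
  shows "mat_adjoint (A * B) = mat_adjoint B * mat_adjoint A"
proof (rule eq_matI)
  fix i j
  assume "i < dim_row (mat_adjoint B * mat_adjoint A)" "j < dim_col (mat_adjoint B * mat_adjoint A)"
  then show "mat_adjoint (A * B) $$ (i, j) = (mat_adjoint B * mat_adjoint A) $$ (i, j)"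
    using assms by (simp add: index_mult_mat_sum mult.commute del: index_mult_mat(1))
qed (use assms in auto)

section \<open>Maps in Kraus form\<close>

text \<open>Two exchanges move the innermost sum outward; this is how the Kraus index is pulled in
  front of a double sum.\<close>

lemma sum_swap3:
  "(\<Sum>s\<in>A. \<Sum>t\<in>B. \<Sum>r\<in>C. g s t r) = (\<Sum>r\<in>C. \<Sum>s\<in>A. \<Sum>t\<in>B. g s t r)"
  by (subst sum.swap[of _ C B]) (rule sum.swap)

text \<open>Splits an index of a flattened matrix into block number \<open>i\<close> and position
  \<open>s\<close> inside the block.\<close>

lemma sum_div_mod:
  "(\<Sum>a<n * d. f a) = (\<Sum>i<n. \<Sum>s<d. f (i * d + s))" for f :: "nat \<Rightarrow> 'a::comm_monoid_add"
proof -
  have "(\<Sum>a<n * d. f a) = (\<Sum>i<n. sum f {i * d..<i * d + d})"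
    by (rule sum.nat_group[symmetric])
  also have "\<dots> = (\<Sum>i<n. \<Sum>s<d. f (i * d + s))"
  proof (rule sum.cong[OF refl])
    fix i
    show "sum f {i * d..<i * d + d} = (\<Sum>s<d. f (i * d + s))"
      using sum.shift_bounds_nat_ivl[of f 0 "i * d" d] by (simp add: add.commute atLeast0LessThan)
  qed
  finally show ?thesis .
qed

text \<open>With the block indices \<open>a\<close>, \<open>b\<close> outermost, the inner double
  sum is the sesquilinear form of one block, to which \<open>kraus_map_quadratic_form\<close>
  applies.\<close>

lemma quadratic_form_flatten_mat:
  assumes X: "X \<in> carrier_mat n n" and w: "w \<in> carrier_vec (n * d)"
  shows "(flatten_mat d X *\<^sub>v w) \<bullet>c w = (\<Sum>a<n. \<Sum>b<n. \<Sum>s<d. \<Sum>t<d.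
           (X $$ (a, b)) $$ (s, t) * w $ (b * d + t) * cnj (w $ (a * d + s)))"
proof -
  have "(flatten_mat d X *\<^sub>v w) \<bullet>c w =
      (\<Sum>k<n * d. (\<Sum>l<n * d. (X $$ (k div d, l div d)) $$ (k mod d, l mod d) * w $ l) * cnj (w $ k))"
    using X w by (simp add: scalar_prod_def atLeast0LessThan flatten_mat_def)
  also have "\<dots> = (\<Sum>a<n. \<Sum>s<d. (\<Sum>b<n. \<Sum>t<d.
           (X $$ (a, b)) $$ (s, t) * w $ (b * d + t)) * cnj (w $ (a * d + s)))"
    unfolding sum_div_mod by (intro sum.cong refl) simp
  also have "\<dots> = (\<Sum>a<n. \<Sum>s<d. \<Sum>b<n. \<Sum>t<d.
           (X $$ (a, b)) $$ (s, t) * w $ (b * d + t) * cnj (w $ (a * d + s)))"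
    by (simp add: sum_distrib_right)
  also have "\<dots> = (\<Sum>a<n. \<Sum>b<n. \<Sum>s<d. \<Sum>t<d.
           (X $$ (a, b)) $$ (s, t) * w $ (b * d + t) * cnj (w $ (a * d + s)))"
    by (intro sum.cong refl sum.swap)
  finally show ?thesis .
qed

text \<open>This is \<open>Y \<mapsto> \<Sum>r<N. K\<^sub>r\<^sup>* Y K\<^sub>r\<close>, where the Kraus operator \<open>K\<^sub>r\<close> is the m-by-n matrix
  with entries \<open>K r i s\<close>.\<close>

definition kraus_map ::
  "nat \<Rightarrow> nat \<Rightarrow> nat \<Rightarrow> (nat \<Rightarrow> nat \<Rightarrow> nat \<Rightarrow> complex) \<Rightarrow> complex mat \<Rightarrow> complex mat" where
  "kraus_map m n N K Y = mat n n (\<lambda>(s, t).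
     \<Sum>r<N. \<Sum>i<m. \<Sum>j<m. cnj (K r i s) * Y $$ (i, j) * K r j t)"

lemma kraus_map_carrier [simp]: "kraus_map m n N K Y \<in> carrier_mat n n"
  by (simp add: kraus_map_def)

lemma index_kraus_map:
  "s < n \<Longrightarrow> t < n \<Longrightarrow>
    kraus_map m n N K Y $$ (s, t) = (\<Sum>r<N. \<Sum>i<m. \<Sum>j<m. cnj (K r i s) * Y $$ (i, j) * K r j t)"
  by (simp add: kraus_map_def)

lemma kraus_map_add:
  assumes "Y \<in> carrier_mat m m" "Z \<in> carrier_mat m m"
  shows "kraus_map m n N K (Y + Z) = kraus_map m n N K Y + kraus_map m n N K Z"
  using assms by (intro eq_matI) (auto simp: kraus_map_def algebra_simps sum.distrib)

lemma kraus_map_smult: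
  assumes "Y \<in> carrier_mat m m"
  shows "kraus_map m n N K (c \<cdot>\<^sub>m Y) = c \<cdot>\<^sub>m kraus_map m n N K Y"
  using assms by (intro eq_matI) (auto simp: kraus_map_def sum_distrib_left mult_ac)

lemma kraus_map_zero: "kraus_map m n N K (0\<^sub>m m m) = 0\<^sub>m n n"
  by (rule eq_matI) (auto simp: kraus_map_def)

text \<open>Taking the adjoint of each \<open>K\<^sub>r\<^sup>* Y K\<^sub>r\<close> only replaces
  \<open>Y\<close> by its adjoint. This handles the adjoint generators of an operator
  system.\<close>

lemma kraus_map_adjoint:
  assumes "Y \<in> carrier_mat m m"
  shows "kraus_map m n N K (mat_adjoint Y) = mat_adjoint (kraus_map m n N K Y)"
proof (rule eq_matI)
  fix s t
  assume "s < dim_row (mat_adjoint (kraus_map m n N K Y))" "t < dim_col (mat_adjoint (kraus_map m n N K Y))"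
  then have st: "s < n" "t < n" by (auto simp: kraus_map_def)
  have "kraus_map m n N K (mat_adjoint Y) $$ (s, t) =
      (\<Sum>r<N. \<Sum>i<m. \<Sum>j<m. cnj (K r i s) * cnj (Y $$ (j, i)) * K r j t)"
    using assms st by (simp add: kraus_map_def)
  also have "\<dots> = (\<Sum>r<N. \<Sum>j<m. \<Sum>i<m. cnj (K r i s) * cnj (Y $$ (j, i)) * K r j t)"
    by (intro sum.cong refl sum.swap)
  also have "\<dots> = mat_adjoint (kraus_map m n N K Y) $$ (s, t)"
    using st by (simp add: kraus_map_def mult_ac)
  finally show "kraus_map m n N K (mat_adjoint Y) $$ (s, t) = mat_adjoint (kraus_map m n N K Y) $$ (s, t)" .
qed (auto simp: kraus_map_def)

text \<open>In coordinates, \<open><K\<^sup>* Y K x, y> = <Y K x, K y>\<close>, summed over the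
  Kraus operators. Two vectors \<open>x\<close>, \<open>y\<close> are kept because an off-diagonal
  block of an amplification pairs different blocks of one long vector.\<close>

lemma kraus_map_quadratic_form:
  fixes x y :: "nat \<Rightarrow> complex"
  shows "(\<Sum>s<n. \<Sum>t<n. kraus_map m n N K Y $$ (s, t) * x t * cnj (y s)) =
    (\<Sum>r<N. \<Sum>i<m. \<Sum>j<m. Y $$ (i, j) * (\<Sum>t<n. K r j t * x t) * cnj (\<Sum>s<n. K r i s * y s))"
proof -
  have "(\<Sum>s<n. \<Sum>t<n. kraus_map m n N K Y $$ (s, t) * x t * cnj (y s)) =
      (\<Sum>s<n. \<Sum>t<n. \<Sum>r<N. \<Sum>i<m. \<Sum>j<m. cnj (K r i s) * Y $$ (i, j) * K r j t * x t * cnj (y s))"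
    by (intro sum.cong refl) (simp add: index_kraus_map sum_distrib_right)
  also have "\<dots> = (\<Sum>r<N. \<Sum>s<n. \<Sum>t<n. \<Sum>i<m. \<Sum>j<m.
      cnj (K r i s) * Y $$ (i, j) * K r j t * x t * cnj (y s))"
    by (rule sum_swap3)
  also have "\<dots> = (\<Sum>r<N. \<Sum>i<m. \<Sum>s<n. \<Sum>t<n. \<Sum>j<m.
      cnj (K r i s) * Y $$ (i, j) * K r j t * x t * cnj (y s))"
    by (intro sum.cong refl sum_swap3)
  also have "\<dots> = (\<Sum>r<N. \<Sum>i<m. \<Sum>j<m. \<Sum>s<n. \<Sum>t<n.
      cnj (K r i s) * Y $$ (i, j) * K r j t * x t * cnj (y s))"
    by (intro sum.cong refl sum_swap3)
  also have "\<dots> = (\<Sum>r<N. \<Sum>i<m. \<Sum>j<m. \<Sum>t<n. \<Sum>s<n.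
      cnj (K r i s) * Y $$ (i, j) * K r j t * x t * cnj (y s))"
    by (intro sum.cong refl sum.swap)
  also have "\<dots> = (\<Sum>r<N. \<Sum>i<m. \<Sum>j<m.
      Y $$ (i, j) * (\<Sum>t<n. K r j t * x t) * cnj (\<Sum>s<n. K r i s * y s))"
    by (intro sum.cong refl) (simp add: sum_distrib_left sum_distrib_right mult_ac)
  finally show ?thesis .
qed

text \<open>The quadratic form of the amplified image at \<open>w\<close> is the sum over \<open>r\<close> of the quadratic
  forms of \<open>X\<close> at \<open>(1 \<otimes> K\<^sub>r) w\<close>.\<close>

lemma completely_positive_kraus:
  assumes eq: "\<And>Y. Y \<in> S \<Longrightarrow> \<phi> Y = kraus_map m n N K Y"
  shows "completely_positive m n S \<phi>"
  unfolding completely_positive_def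
proof (intro allI ballI impI)
  fix k and X :: "complex mat mat"
  assume X: "X \<in> carrier_mat k k" and S: "elements_mat X \<subseteq> S"
    and pos: "pos_semidef (k * m) (flatten_mat m X)"
  \<comment> \<open>Agreement with the Kraus map on \<open>S\<close> suffices since all entries of
    \<open>X\<close> lie there; hence the lemma also covers \<open>inv_into\<close>.\<close>
  have XS: "X $$ (a, b) \<in> S" if "a < k" "b < k" for a b
    using S X that by (blast intro: elements_matI)
  show "pos_semidef (k * n) (flatten_mat n (map_mat \<phi> X))"
    unfolding pos_semidef_def
  proof (intro conjI ballI)
    show "flatten_mat n (map_mat \<phi> X) \<in> carrier_mat (k * n) (k * n)"
      using X by (intro carrier_matI) (auto simp: flatten_mat_def)
  next
    fix w :: "complex vec"
    assume w: "w \<in> carrier_vec (k * n)"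
    define z where "z r = vec (k * m) (\<lambda>l. \<Sum>t<n. K r (l mod m) t * w $ ((l div m) * n + t))" for r
    have lt: "a * m + i < k * m" if "a < k" "i < m" for a i
    proof -
      have "a * m + i < Suc a * m" using that by simp
      also have "\<dots> \<le> k * m" using that by (intro mult_le_mono1) simp
      finally show ?thesis .
    qed
    have z: "z r $ (a * m + i) = (\<Sum>t<n. K r i t * w $ (a * n + t))" if "a < k" "i < m" for r a i
      using lt[OF that] that by (simp add: z_def)
    have zc: "z r \<in> carrier_vec (k * m)" for r
      by (simp add: z_def)
    have "(flatten_mat n (map_mat \<phi> X) *\<^sub>v w) \<bullet>c w = (\<Sum>a<k. \<Sum>b<k. \<Sum>s<n. \<Sum>t<n.
        (map_mat \<phi> X $$ (a, b)) $$ (s, t) * w $ (b * n + t) * cnj (w $ (a * n + s)))"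
      using X w by (intro quadratic_form_flatten_mat) auto
    also have "\<dots> = (\<Sum>a<k. \<Sum>b<k. \<Sum>s<n. \<Sum>t<n.
        kraus_map m n N K (X $$ (a, b)) $$ (s, t) * w $ (b * n + t) * cnj (w $ (a * n + s)))"
      using X XS by (intro sum.cong refl) (simp add: eq)
    also have "\<dots> = (\<Sum>a<k. \<Sum>b<k. \<Sum>r<N. \<Sum>i<m. \<Sum>j<m.
        (X $$ (a, b)) $$ (i, j) * z r $ (b * m + j) * cnj (z r $ (a * m + i)))"
      unfolding kraus_map_quadratic_form by (intro sum.cong refl) (simp add: z)
    also have "\<dots> = (\<Sum>r<N. \<Sum>a<k. \<Sum>b<k. \<Sum>i<m. \<Sum>j<m.
        (X $$ (a, b)) $$ (i, j) * z r $ (b * m + j) * cnj (z r $ (a * m + i)))"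
      by (rule sum_swap3)
    also have "\<dots> = (\<Sum>r<N. (flatten_mat m X *\<^sub>v z r) \<bullet>c z r)"
      by (simp add: quadratic_form_flatten_mat[OF X zc])
    also have "\<dots> \<ge> 0"
      using pos zc by (intro sum_nonneg) (auto simp: pos_semidef_def)
    finally show "0 \<le> (flatten_mat n (map_mat \<phi> X) *\<^sub>v w) \<bullet>c w" .
  qed
qed

section \<open>Operator systems\<close>

text \<open>Restates the span as the least subspace containing the generators. Minimality serves
  below as the induction principle for operator systems.\<close>

lemma op_system_properties:
  assumes "set xs \<subseteq> carrier_mat d d"
  shows op_system_submodule: "submodule class_ring (op_system d xs) (module_mat TYPE(complex) d d)"
    and op_system_generators: "{1\<^sub>m d} \<union> set xs \<union> mat_adjoint ` set xs \<subseteq> op_system d xs"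
    and op_system_minimal: "\<And>N. submodule class_ring N (module_mat TYPE(complex) d d) \<Longrightarrow>
      {1\<^sub>m d} \<union> set xs \<union> mat_adjoint ` set xs \<subseteq> N \<Longrightarrow> op_system d xs \<subseteq> N"
proof -
  interpret V: Module.module "class_ring :: complex ring" "module_mat TYPE(complex) d d"
    using matrix_vs[where 'a = complex] by (simp add: vectorspace_def)
  have gens: "{1\<^sub>m d} \<union> set xs \<union> mat_adjoint ` set xs \<subseteq> carrier (module_mat TYPE(complex) d d)"
    using assms by (auto simp: matrix_vs_simps)
  show "submodule class_ring (op_system d xs) (module_mat TYPE(complex) d d)"
    unfolding op_system_def by (rule V.span_is_submodule[OF gens])
  show "{1\<^sub>m d} \<union> set xs \<union> mat_adjoint ` set xs \<subseteq> op_system d xs"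
    unfolding op_system_def by (rule V.in_own_span[OF gens])
  show "op_system d xs \<subseteq> N" if "submodule class_ring N (module_mat TYPE(complex) d d)"
    "{1\<^sub>m d} \<union> set xs \<union> mat_adjoint ` set xs \<subseteq> N" for N
    unfolding op_system_def by (rule V.span_is_subset[OF that(2,1)])
qed

lemma submodule_matI:
  assumes "N \<subseteq> carrier_mat d d" "0\<^sub>m d d \<in> N"
    and "\<And>A B. A \<in> N \<Longrightarrow> B \<in> N \<Longrightarrow> A + B \<in> N"
    and "\<And>c A. A \<in> N \<Longrightarrow> c \<cdot>\<^sub>m A \<in> N"
  shows "submodule class_ring N (module_mat TYPE(complex) d d)"
proof -
  have "Module.module (class_ring :: complex ring) (module_mat TYPE(complex) d d)"
    using matrix_vs[where 'a = complex] by (simp add: vectorspace_def)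
  then show ?thesis
    using assms by (auto simp: submodule_def matrix_vs_simps)
qed

lemma op_system_carrier:
  assumes "set xs \<subseteq> carrier_mat d d"
  shows "op_system d xs \<subseteq> carrier_mat d d"
  using submodule.subset[OF op_system_submodule[OF assms]] by (simp add: matrix_vs_simps)

text \<open>The preimage of the target system is a subspace, and it contains the generators of the
  source system; adjoints are covered by \<open>kraus_map_adjoint\<close>.\<close>

lemma kraus_map_op_system:
  assumes xs: "set xs \<subseteq> carrier_mat m m" and ys: "set ys \<subseteq> carrier_mat n n"
    and one: "kraus_map m n N K (1\<^sub>m m) = 1\<^sub>m n"
    and gen: "kraus_map m n N K ` set xs \<subseteq> set ys"
    and Y: "Y \<in> op_system m xs"
  shows "kraus_map m n N K Y \<in> op_system n ys"
proof -
  interpret S: submodule "class_ring :: complex ring" "op_system n ys" "module_mat TYPE(complex) n n"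
    by (rule op_system_submodule[OF ys])
  note S = S.m_closed[unfolded matrix_vs_simps] S.zero_closed[unfolded matrix_vs_simps]
    S.smult_closed[unfolded matrix_vs_simps, OF UNIV_I]
  let ?M = "{Y \<in> carrier_mat m m. kraus_map m n N K Y \<in> op_system n ys}"
  have "op_system m xs \<subseteq> ?M"
  proof (rule op_system_minimal[OF xs])
    show "submodule class_ring ?M (module_mat TYPE(complex) m m)"
      by (rule submodule_matI) (auto simp: kraus_map_add kraus_map_smult kraus_map_zero S)
    show "{1\<^sub>m m} \<union> set xs \<union> mat_adjoint ` set xs \<subseteq> ?M"
      using xs gen op_system_generators[OF ys] by (auto simp: one kraus_map_adjoint subset_iff)
  qed
  with Y show ?thesis by blast
qed

text \<open>The fixed points of the composition form a subspace. It contains the adjoint generators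
  because both maps respect adjoints.\<close>

lemma kraus_map_inverse_op_system:
  assumes xs: "set xs \<subseteq> carrier_mat m m"
    and one: "kraus_map m n N K (1\<^sub>m m) = 1\<^sub>m n" "kraus_map n m N' K' (1\<^sub>m n) = 1\<^sub>m m"
    and gen: "\<And>x. x \<in> set xs \<Longrightarrow> kraus_map n m N' K' (kraus_map m n N K x) = x"
    and Y: "Y \<in> op_system m xs"
  shows "kraus_map n m N' K' (kraus_map m n N K Y) = Y"
proof -
  let ?M = "{Y \<in> carrier_mat m m. kraus_map n m N' K' (kraus_map m n N K Y) = Y}"
  have "op_system m xs \<subseteq> ?M"
  proof (rule op_system_minimal[OF xs])
    show "submodule class_ring ?M (module_mat TYPE(complex) m m)"
      by (rule submodule_matI) (auto simp: kraus_map_add kraus_map_smult kraus_map_zero)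
    show "{1\<^sub>m m} \<union> set xs \<union> mat_adjoint ` set xs \<subseteq> ?M"
      using xs gen by (auto simp: one kraus_map_adjoint subset_iff)
  qed
  with Y show ?thesis by blast
qed

text \<open>The criterion that reduces the theorem to generators: Kraus maps are linear and
  completely positive by their form, so it remains to see that two of them exchange the identities
  and the tuples.\<close>

lemma complete_order_equivalent_kraus:
  assumes xs: "set xs \<subseteq> carrier_mat m m" and ys: "set ys \<subseteq> carrier_mat n n"
    and len: "length xs = length ys"
    and one: "kraus_map m n N K (1\<^sub>m m) = 1\<^sub>m n" "kraus_map n m N' K' (1\<^sub>m n) = 1\<^sub>m m"
    and gen: "\<And>k. k < length xs \<Longrightarrow> kraus_map m n N K (xs ! k) = ys ! k"
      "\<And>k. k < length xs \<Longrightarrow> kraus_map n m N' K' (ys ! k) = xs ! k"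
  shows "complete_order_equivalent m xs n ys"
proof -
  let ?F = "kraus_map m n N K" and ?G = "kraus_map n m N' K'"
  let ?X = "op_system m xs" and ?Y = "op_system n ys"
  have gen': "?F ` set xs \<subseteq> set ys" "?G ` set ys \<subseteq> set xs"
    "\<And>x. x \<in> set xs \<Longrightarrow> ?G (?F x) = x" "\<And>y. y \<in> set ys \<Longrightarrow> ?F (?G y) = y"
    using len gen by (force simp: in_set_conv_nth)+
  have F: "?F A \<in> ?Y" if "A \<in> ?X" for A
    using kraus_map_op_system[OF xs ys one(1) gen'(1) that] .
  have G: "?G B \<in> ?X" if "B \<in> ?Y" for B
    using kraus_map_op_system[OF ys xs one(2) gen'(2) that] .
  have GF: "?G (?F A) = A" if "A \<in> ?X" for A
    using kraus_map_inverse_op_system[OF xs one gen'(3) that] .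
  have FG: "?F (?G B) = B" if "B \<in> ?Y" for B
    using kraus_map_inverse_op_system[OF ys one(2,1) gen'(4) that] .
  have bij: "bij_betw ?F ?X ?Y"
    by (rule bij_betw_byWitness[where f' = ?G]) (use F G GF FG in auto)
  \<comment> \<open>\<open>inv_into\<close> is controlled only on the image, so the identification
    with \<open>?G\<close> is made on \<open>?Y\<close>, the domain on which complete positivity is
    tested.\<close>
  have inv: "inv_into ?X ?F B = ?G B" if "B \<in> ?Y" for B
    using that by (intro inv_into_f_eq) (use bij G FG in \<open>auto simp: bij_betw_def\<close>)
  have "?F \<in> LinearCombinations.module_hom class_ring (op_system_space m xs) (op_system_space n ys)"
    using F op_system_carrier[OF xs]
    by (auto simp: LinearCombinations.module_hom_def op_system_space_def matrix_vs_simps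
        kraus_map_add kraus_map_smult subset_iff)
  moreover have "unital_completely_positive m n ?X ?F"
    by (auto simp: unital_completely_positive_def one intro: completely_positive_kraus)
  moreover have "unital_completely_positive n m ?Y (inv_into ?X ?F)"
    using op_system_generators[OF ys]
    by (auto simp: unital_completely_positive_def one inv intro: completely_positive_kraus)
  ultimately show ?thesis
    unfolding complete_order_equivalent_def using bij len gen(1) by blast
qed

lemma smult_smult_mat: "c \<cdot>\<^sub>m (k \<cdot>\<^sub>m A) = (c * k) \<cdot>\<^sub>m A" for A :: "complex mat"
  by (rule eq_matI) auto

lemma one_smult_mat [simp]: "1 \<cdot>\<^sub>m A = A" for A :: "complex mat"
  by (rule eq_matI) auto

lemmas square_mat_simps = mult_carrier_mat[of _ d d _ d] assoc_mult_mat[of _ d d _ d _ d]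
  mult_smult_assoc_mat[of _ d d _ d] mult_smult_distrib[of _ d d _ d]
  left_mult_one_mat[of _ d d] right_mult_one_mat[of _ d d] for d :: nat

section \<open>Matrix units generated by a Weyl pair\<close>

text \<open>The size \<open>d\<close> is explicit, so that the sum is always a
  \<open>d\<close>-by-\<open>d\<close> matrix and the empty sum is the zero matrix.\<close>

definition mat_sum :: "nat \<Rightarrow> ('a \<Rightarrow> complex mat) \<Rightarrow> 'a set \<Rightarrow> complex mat" where
  "mat_sum d f I = mat d d (\<lambda>ij. \<Sum>k\<in>I. f k $$ ij)"

lemma mat_sum_carrier [simp]: "mat_sum d f I \<in> carrier_mat d d"
  by (simp add: mat_sum_def)

lemma index_mat_sum: "i < d \<Longrightarrow> j < d \<Longrightarrow> mat_sum d f I $$ (i, j) = (\<Sum>k\<in>I. f k $$ (i, j))"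
  by (simp add: mat_sum_def)

lemma mat_sum_cong: "(\<And>k. k \<in> I \<Longrightarrow> f k = g k) \<Longrightarrow> mat_sum d f I = mat_sum d g I"
  by (simp add: mat_sum_def)

lemma mult_mat_sum:
  assumes A: "A \<in> carrier_mat d d" and f: "\<And>k. k \<in> I \<Longrightarrow> f k \<in> carrier_mat d d"
  shows "A * mat_sum d f I = mat_sum d (\<lambda>k. A * f k) I"
proof (rule eq_matI)
  fix i j
  assume "i < dim_row (mat_sum d (\<lambda>k. A * f k) I)" "j < dim_col (mat_sum d (\<lambda>k. A * f k) I)"
  then have ij: "i < d" "j < d" by (auto simp: mat_sum_def)
  have "(A * mat_sum d f I) $$ (i, j) = (\<Sum>l<d. \<Sum>k\<in>I. A $$ (i, l) * f k $$ (l, j))"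
    using A ij by (simp add: scalar_prod_def mat_sum_def sum_distrib_left atLeast0LessThan)
  also have "\<dots> = (\<Sum>k\<in>I. \<Sum>l<d. A $$ (i, l) * f k $$ (l, j))"
    by (rule sum.swap)
  also have "\<dots> = (\<Sum>k\<in>I. (A * f k) $$ (i, j))"
    using A carrier_matD[OF f] ij
    by (intro sum.cong refl) (simp add: scalar_prod_def atLeast0LessThan)
  finally show "(A * mat_sum d f I) $$ (i, j) = mat_sum d (\<lambda>k. A * f k) I $$ (i, j)"
    using ij by (simp add: index_mat_sum)
qed (use A in \<open>auto simp: mat_sum_def\<close>)

lemma mat_sum_mult:
  assumes A: "A \<in> carrier_mat d d" and f: "\<And>k. k \<in> I \<Longrightarrow> f k \<in> carrier_mat d d"
  shows "mat_sum d f I * A = mat_sum d (\<lambda>k. f k * A) I"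
proof (rule eq_matI)
  fix i j
  assume "i < dim_row (mat_sum d (\<lambda>k. f k * A) I)" "j < dim_col (mat_sum d (\<lambda>k. f k * A) I)"
  then have ij: "i < d" "j < d" by (auto simp: mat_sum_def)
  have "(mat_sum d f I * A) $$ (i, j) = (\<Sum>l<d. \<Sum>k\<in>I. f k $$ (i, l) * A $$ (l, j))"
    using A ij by (simp add: scalar_prod_def mat_sum_def sum_distrib_right atLeast0LessThan)
  also have "\<dots> = (\<Sum>k\<in>I. \<Sum>l<d. f k $$ (i, l) * A $$ (l, j))"
    by (rule sum.swap)
  also have "\<dots> = (\<Sum>k\<in>I. (f k * A) $$ (i, j))"
    using A carrier_matD[OF f] ij
    by (intro sum.cong refl) (simp add: scalar_prod_def atLeast0LessThan)
  finally show "(mat_sum d f I * A) $$ (i, j) = mat_sum d (\<lambda>k. f k * A) I $$ (i, j)"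
    using ij by (simp add: index_mat_sum)
qed (use A in \<open>auto simp: mat_sum_def\<close>)

section \<open>Powers of unitaries and of matrices commuting up to a scalar\<close>

lemma pow_mat_Suc_left:
  assumes "A \<in> carrier_mat d d"
  shows "A ^\<^sub>m Suc k = A * A ^\<^sub>m k"
proof (induction k)
  case 0
  then show ?case using assms by simp
next
  case (Suc k)
  have "A ^\<^sub>m Suc (Suc k) = (A * A ^\<^sub>m k) * A"
    using Suc by simp
  also have "\<dots> = A * A ^\<^sub>m Suc k"
    using assms by (simp add: square_mat_simps[where d = d])
  finally show ?case .
qed

text \<open>Each of the \<open>k\<close> factors \<open>B\<close> that \<open>A\<close> passes
  contributes one factor \<open>c\<close>.\<close>

lemma mult_pow_mat_q_commute:
  fixes A B :: "complex mat"
  assumes A: "A \<in> carrier_mat d d" and B: "B \<in> carrier_mat d d" and q: "A * B = c \<cdot>\<^sub>m (B * A)"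
  shows "A * B ^\<^sub>m k = c ^ k \<cdot>\<^sub>m (B ^\<^sub>m k * A)"
proof (induction k)
  case 0
  then show ?case using A B by (intro eq_matI) auto
next
  case (Suc k)
  have "A * B ^\<^sub>m Suc k = (A * B ^\<^sub>m k) * B"
    using A B by (simp add: square_mat_simps[where d = d])
  also have "\<dots> = c ^ k \<cdot>\<^sub>m (B ^\<^sub>m k * (A * B))"
    using A B by (simp add: Suc square_mat_simps[where d = d])
  also have "\<dots> = c ^ Suc k \<cdot>\<^sub>m (B ^\<^sub>m Suc k * A)"
    using A B
    by (simp add: q square_mat_simps[where d = d] smult_smult_mat mult.commute)
  finally show ?case .
qed

lemma pow_mat_q_commute:
  fixes A B :: "complex mat"
  assumes A: "A \<in> carrier_mat d d" and B: "B \<in> carrier_mat d d" and q: "A * B = c \<cdot>\<^sub>m (B * A)"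
  shows "A ^\<^sub>m j * B ^\<^sub>m k = c ^ (j * k) \<cdot>\<^sub>m (B ^\<^sub>m k * A ^\<^sub>m j)"
proof (induction j)
  case 0
  then show ?case using A B by (intro eq_matI) auto
next
  case (Suc j)
  have "A ^\<^sub>m Suc j * B ^\<^sub>m k = A ^\<^sub>m j * (A * B ^\<^sub>m k)"
    using A B by (simp add: square_mat_simps[where d = d])
  also have "\<dots> = c ^ k \<cdot>\<^sub>m ((A ^\<^sub>m j * B ^\<^sub>m k) * A)"
    using A B by (simp add: mult_pow_mat_q_commute[OF A B q] square_mat_simps[where d = d])
  also have "\<dots> = c ^ (Suc j * k) \<cdot>\<^sub>m (B ^\<^sub>m k * A ^\<^sub>m Suc j)"
    using A B by (simp add: Suc square_mat_simps[where d = d]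
        smult_smult_mat power_add)
  finally show ?case .
qed

lemma unitary_matrix_pow:
  assumes "unitary_matrix d u"
  shows "unitary_matrix d (u ^\<^sub>m k)"
proof (induction k)
  case 0
  then show ?case using assms by (auto simp: unitary_matrix_def)
next
  case (Suc k)
  let ?w = "u ^\<^sub>m k"
  have u: "u \<in> carrier_mat d d" "mat_adjoint u * u = 1\<^sub>m d" "u * mat_adjoint u = 1\<^sub>m d"
    using assms by (auto simp: unitary_matrix_def)
  have w: "?w \<in> carrier_mat d d" "mat_adjoint ?w * ?w = 1\<^sub>m d" "?w * mat_adjoint ?w = 1\<^sub>m d"
    using Suc by (auto simp: unitary_matrix_def)
  have adj: "mat_adjoint (?w * u) = mat_adjoint u * mat_adjoint ?w"
    using u w by (intro mat_adjoint_mult)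
  have "mat_adjoint (?w * u) * (?w * u) = mat_adjoint u * ((mat_adjoint ?w * ?w) * u)"
    using u(1) w(1) by (simp add: adj square_mat_simps[where d = d])
  moreover have "(?w * u) * mat_adjoint (?w * u) = ?w * ((u * mat_adjoint u) * mat_adjoint ?w)"
    using u(1) w(1) by (simp add: adj square_mat_simps[where d = d])
  ultimately show ?case
    using u w by (simp add: unitary_matrix_def square_mat_simps[where d = d])
qed

section \<open>Weyl pairs: roots of unity and the projection onto the fixed space of
  \<open>u\<close>\<close>

locale weyl_pair =
  fixes p d :: nat and \<zeta> :: complex and u v :: "complex mat"
  assumes root: "primitive_root_of_unity p \<zeta>"
    and d_pos: "1 \<le> d"
    and unitary_u: "unitary_matrix d u" and unitary_v: "unitary_matrix d v"
    and pow_u: "u ^\<^sub>m p = 1\<^sub>m d" and pow_v: "v ^\<^sub>m p = 1\<^sub>m d"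
    and commute: "u * v = \<zeta> \<cdot>\<^sub>m (v * u)"
begin

lemma p_pos: "0 < p"
  using root by (simp add: primitive_root_of_unity_def)

lemma u_carrier [simp]: "u \<in> carrier_mat d d" and v_carrier [simp]: "v \<in> carrier_mat d d"
  using unitary_u unitary_v by (auto simp: unitary_matrix_def)

lemmas assoc_d = assoc_mult_mat[of _ d d _ d _ d]
lemmas sq_simps = square_mat_simps[where d = d] smult_smult_mat

lemma norm_root: "cmod \<zeta> = 1"
proof -
  have "cmod \<zeta> ^ p = 1 ^ p"
    using root by (simp add: primitive_root_of_unity_def flip: norm_power)
  then show ?thesis
    using p_pos power_eq_imp_eq_base[of "cmod \<zeta>" p 1] by simp
qed

lemma cnj_root: "cnj \<zeta> * \<zeta> = 1" "\<zeta> * cnj \<zeta> = 1"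
  using norm_root complex_norm_square[of \<zeta>] by (simp_all add: mult.commute)

lemma cnj_root_pow: "cnj \<zeta> ^ k * \<zeta> ^ k = 1"
  by (simp add: cnj_root flip: power_mult_distrib)

text \<open>A coincidence would give \<open>\<zeta> ^ (t - s) = 1\<close> with an exponent strictly
  between 0 and \<open>p\<close>. The lemma makes the eigenvalues of \<open>u\<close> on the
  \<open>Q s\<close> distinct.\<close>

lemma root_pow_inj:
  assumes "s < p" "t < p" "\<zeta> ^ s = \<zeta> ^ t"
  shows "s = t"
proof -
  have False if "s < t" "t < p" "\<zeta> ^ s = \<zeta> ^ t" for s t
  proof -
    have "\<zeta> ^ t = \<zeta> ^ s * \<zeta> ^ (t - s)"
      using that(1) by (simp flip: power_add)
    then have "\<zeta> ^ s * 1 = \<zeta> ^ s * \<zeta> ^ (t - s)"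
      using that(3) by simp
    moreover have "\<zeta> \<noteq> 0"
      using norm_root by auto
    ultimately have "\<zeta> ^ (t - s) = 1" by simp
    moreover have "0 < t - s" "t - s < p" using that by auto
    ultimately show False
      using root unfolding primitive_root_of_unity_def by blast
  qed
  then show ?thesis
    using assms by (metis linorder_neqE_nat)
qed

text \<open>For \<open>k\<close> nonzero this is a geometric sum whose ratio differs from 1 and has
  \<open>p\<close>-th power 1.\<close>

lemma sum_root_powers:
  assumes "k < p"
  shows "(\<Sum>s<p. cnj \<zeta> ^ (k * s)) = (if k = 0 then of_nat p else 0)"
proof (cases "k = 0")
  case False
  have "\<zeta> ^ k \<noteq> 1"
    using False assms root by (simp add: primitive_root_of_unity_def)
  then have ne: "cnj \<zeta> ^ k \<noteq> 1"
    by (metis complex_cnj_cnj complex_cnj_one complex_cnj_power)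
  have "cnj \<zeta> ^ p = 1"
    using root unfolding primitive_root_of_unity_def by (metis complex_cnj_one complex_cnj_power)
  then have "(cnj \<zeta> ^ k) ^ p = 1"
    by (metis mult.commute power_mult power_one)
  then show ?thesis
    using False geometric_sum[OF ne, of p] by (simp add: power_mult)
qed simp

lemma v_u_commute: "v * u = cnj \<zeta> \<cdot>\<^sub>m (u * v)"
  by (simp add: commute smult_smult_mat cnj_root)

text \<open>Averaging the powers of \<open>u\<close> gives its spectral projection for the eigenvalue 1.\<close>

definition proj :: "complex mat" where
  "proj = mat_sum d (\<lambda>k. (1 / of_nat p) \<cdot>\<^sub>m u ^\<^sub>m k) {..<p}"

lemma proj_carrier [simp]: "proj \<in> carrier_mat d d"
  by (simp add: proj_def)

text \<open>Multiplication by \<open>u\<close> shifts the exponents in the average cyclically, since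
  \<open>u ^\<^sub>m p\<close> equals \<open>u ^\<^sub>m 0\<close>.\<close>

lemma mult_u_proj: "u * proj = proj"
proof -
  have shift: "(\<Sum>k<p. (u ^\<^sub>m Suc k) $$ ij) = (\<Sum>k<p. (u ^\<^sub>m k) $$ ij)" for ij
    using sum.lessThan_Suc_shift[of "\<lambda>k. (u ^\<^sub>m k) $$ ij" p] carrier_matD[OF u_carrier] pow_u
    by simp
  have "u * proj = mat_sum d (\<lambda>k. (1 / of_nat p) \<cdot>\<^sub>m u ^\<^sub>m Suc k) {..<p}"
    unfolding proj_def
    by (subst mult_mat_sum) (auto simp del: pow_mat.simps simp: sq_simps pow_mat_Suc_left[OF u_carrier])
  also have "\<dots> = proj"
    unfolding proj_def using carrier_matD[OF u_carrier] shift
    by (intro eq_matI) (auto simp: index_mat_sum mat_sum_def simp flip: sum_divide_distrib simp del: pow_mat.simps)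
  finally show ?thesis .
qed

text \<open>The adjoint of \<open>u\<close> is its inverse, so it inverts the eigenvalue
  \<open>c\<close>; as \<open>c\<close> has modulus 1, the inverse is \<open>cnj c\<close>.\<close>

lemma mult_adjoint_u:
  assumes "A \<in> carrier_mat d d" "u * A = c \<cdot>\<^sub>m A" "cnj c * c = 1"
  shows "mat_adjoint u * A = cnj c \<cdot>\<^sub>m A"
proof -
  have "A = mat_adjoint u * (u * A)"
    using assms(1) unitary_u by (simp add: unitary_matrix_def del: assoc_mult_mat add: sq_simps(1) flip: assoc_d)
  also have "\<dots> = c \<cdot>\<^sub>m (mat_adjoint u * A)"
    using assms by (simp add: sq_simps)
  finally have "cnj c \<cdot>\<^sub>m A = cnj c \<cdot>\<^sub>m (c \<cdot>\<^sub>m (mat_adjoint u * A))" by simp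
  then show ?thesis
    using assms(3) by (simp add: smult_smult_mat)
qed

text \<open>Write P for \<open>proj\<close>. From \<open>u\<^sup>* P = P\<close> follows
  \<open>P\<^sup>* u ^ k = P\<^sup>*\<close> for all \<open>k\<close>, and averaging gives
  \<open>P\<^sup>* P = P\<^sup>*\<close>. The left side is self-adjoint, so both claims
  follow.\<close>

lemma adjoint_proj: "mat_adjoint proj = proj" and proj_idem: "proj * proj = proj"
proof -
  have "mat_adjoint u * proj = proj"
    using mult_adjoint_u[of proj 1] mult_u_proj by simp
  then have "mat_adjoint proj * u = mat_adjoint proj"
    using mat_adjoint_mult[of "mat_adjoint u" d d proj d] by simp
  then have pow: "mat_adjoint proj * u ^\<^sub>m k = mat_adjoint proj" for k
    by (induction k) (simp_all add: carrier_matD[OF u_carrier] carrier_matD[OF proj_carrier] del: assoc_mult_mat add: sq_simps(1) flip: assoc_d)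
  have eq: "mat_adjoint proj * proj = mat_adjoint proj"
  proof -
    have "mat_adjoint proj * proj = mat_sum d (\<lambda>k. (1 / of_nat p) \<cdot>\<^sub>m mat_adjoint proj) {..<p}"
      by (subst (2) proj_def, subst mult_mat_sum) (auto simp: sq_simps pow)
    also have "\<dots> = mat_adjoint proj"
      using p_pos carrier_matD[OF proj_carrier] by (intro eq_matI) (auto simp: mat_sum_def)
    finally show ?thesis .
  qed
  have "proj = mat_adjoint (mat_adjoint proj * proj)"
    by (simp add: eq)
  also have "\<dots> = mat_adjoint proj * proj"
    using mat_adjoint_mult[of "mat_adjoint proj" d d proj d] by simp
  finally show "mat_adjoint proj = proj"
    using eq by simp
  with eq show "proj * proj = proj" by simp
qed

section \<open>The partial isometries \<open>Q s\<close>: eigenvalues, orthogonality and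
  completeness\<close>

definition Q :: "nat \<Rightarrow> complex mat" where
  "Q s = v ^\<^sub>m s * proj"

lemma Q_carrier [simp]: "Q s \<in> carrier_mat d d"
  by (simp add: Q_def sq_simps)

lemma dim_Q [simp]: "dim_row (Q s) = d" "dim_col (Q s) = d"
  using carrier_matD[OF Q_carrier] by auto

text \<open>Moving \<open>u\<close> past \<open>s\<close> factors \<open>v\<close> costs
  \<open>\<zeta> ^ s\<close>, after which \<open>proj\<close> absorbs it.\<close>

lemma u_Q: "u * Q s = \<zeta> ^ s \<cdot>\<^sub>m Q s"
proof -
  have "u * Q s = (u * v ^\<^sub>m s) * proj"
    by (simp add: Q_def sq_simps)
  also have "\<dots> = \<zeta> ^ s \<cdot>\<^sub>m (v ^\<^sub>m s * (u * proj))"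
    unfolding mult_pow_mat_q_commute[OF u_carrier v_carrier commute] by (simp add: sq_simps)
  finally show ?thesis
    by (simp add: mult_u_proj Q_def)
qed

lemma v_Q:
  assumes "s < p"
  shows "v * Q s = Q (Suc s mod p)"
proof -
  have "v * Q s = v ^\<^sub>m Suc s * proj"
    by (simp add: Q_def sq_simps pow_mat_Suc_left[OF v_carrier] del: pow_mat.simps)
  \<comment> \<open>Only \<open>Suc s = p\<close> wraps around: there both powers are the
    identity.\<close>
  also have "v ^\<^sub>m Suc s = v ^\<^sub>m (Suc s mod p)"
    using assms pow_v carrier_matD[OF v_carrier] by (cases "Suc s = p") auto
  finally show ?thesis
    by (simp add: Q_def)
qed

text \<open>For \<open>s = t\<close> the unitary \<open>v ^\<^sub>m t\<close> cancels. Otherwise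
  \<open>(Q s)\<^sup>* u (Q t)\<close> is computed in two ways, with \<open>u\<close> acting to the
  left and to the right; since the eigenvalues differ, the product vanishes.\<close>

lemma adjoint_Q_mult_Q:
  assumes "s < p" "t < p"
  shows "mat_adjoint (Q s) * Q t = (if s = t then proj else 0\<^sub>m d d)"
proof (cases "s = t")
  case True
  have "mat_adjoint (Q t) * Q t = proj * ((mat_adjoint (v ^\<^sub>m t) * v ^\<^sub>m t) * proj)"
    using mat_adjoint_mult[of "v ^\<^sub>m t" d d proj d] by (simp add: Q_def adjoint_proj sq_simps)
  also have "\<dots> = proj"
    using unitary_matrix_pow[OF unitary_v, of t] by (simp add: unitary_matrix_def proj_idem sq_simps)
  finally show ?thesis using True by simp
next
  case False
  let ?A = "mat_adjoint (Q s) * Q t"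
  have "mat_adjoint u * Q s = cnj (\<zeta> ^ s) \<cdot>\<^sub>m Q s"
    by (rule mult_adjoint_u) (simp_all add: u_Q cnj_root_pow)
  then have "mat_adjoint (Q s) * u = \<zeta> ^ s \<cdot>\<^sub>m mat_adjoint (Q s)"
    using mat_adjoint_mult[of "mat_adjoint u" d d "Q s" d] by (simp add: mat_adjoint_smult)
  then have "\<zeta> ^ s \<cdot>\<^sub>m ?A = (mat_adjoint (Q s) * u) * Q t"
    by (simp add: sq_simps)
  also have "\<dots> = mat_adjoint (Q s) * (u * Q t)"
    by (simp add: sq_simps)
  also have "\<dots> = \<zeta> ^ t \<cdot>\<^sub>m ?A"
    by (simp add: u_Q sq_simps)
  finally have eq: "\<zeta> ^ s \<cdot>\<^sub>m ?A = \<zeta> ^ t \<cdot>\<^sub>m ?A" .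
  have ne: "\<zeta> ^ s \<noteq> \<zeta> ^ t"
    using False assms root_pow_inj by blast
  have "?A = 0\<^sub>m d d"
  proof (rule eq_matI)
    fix i j
    assume "i < dim_row (0\<^sub>m d d :: complex mat)" "j < dim_col (0\<^sub>m d d :: complex mat)"
    moreover have "(\<zeta> ^ s \<cdot>\<^sub>m ?A) $$ (i, j) = (\<zeta> ^ t \<cdot>\<^sub>m ?A) $$ (i, j)"
      by (simp only: eq)
    moreover have "dim_row ?A = d" "dim_col ?A = d"
      by auto
    ultimately show "?A $$ (i, j) = (0\<^sub>m d d :: complex mat) $$ (i, j)"
      using ne by (auto simp del: index_mult_mat)
  qed auto
  then show ?thesis using False by simp
qed

text \<open>Conjugating \<open>proj\<close> by \<open>v ^\<^sub>m s\<close> multiplies the term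
  \<open>u ^\<^sub>m k\<close> of the average by \<open>cnj \<zeta> ^ (k * s)\<close>. Summing over
  \<open>s\<close> removes every term except \<open>k = 0\<close>, which gives the identity.\<close>

lemma Q_complete: "mat_sum d (\<lambda>s. Q s * mat_adjoint (Q s)) {..<p} = 1\<^sub>m d"
proof -
  have summand: "Q s * mat_adjoint (Q s) =
      mat_sum d (\<lambda>k. (cnj \<zeta> ^ (k * s) / of_nat p) \<cdot>\<^sub>m u ^\<^sub>m k) {..<p}" for s
  proof -
    have v: "v ^\<^sub>m s * mat_adjoint (v ^\<^sub>m s) = 1\<^sub>m d"
      using unitary_matrix_pow[OF unitary_v, of s] by (simp add: unitary_matrix_def)
    have "Q s * mat_adjoint (Q s) = v ^\<^sub>m s * ((proj * proj) * mat_adjoint (v ^\<^sub>m s))"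
      using mat_adjoint_mult[of "v ^\<^sub>m s" d d proj d] by (simp add: Q_def adjoint_proj sq_simps)
    also have "\<dots> = mat_sum d (\<lambda>k. v ^\<^sub>m s * (((1 / of_nat p) \<cdot>\<^sub>m u ^\<^sub>m k) * mat_adjoint (v ^\<^sub>m s))) {..<p}"
      unfolding proj_idem by (subst proj_def, subst mat_sum_mult, simp, simp, subst mult_mat_sum) (auto simp: sq_simps)
    also have "\<dots> = mat_sum d (\<lambda>k. (cnj \<zeta> ^ (k * s) / of_nat p) \<cdot>\<^sub>m u ^\<^sub>m k) {..<p}"
    proof (rule mat_sum_cong)
      fix k
      have "v ^\<^sub>m s * (((1 / of_nat p) \<cdot>\<^sub>m u ^\<^sub>m k) * mat_adjoint (v ^\<^sub>m s)) =
          (1 / of_nat p) \<cdot>\<^sub>m ((v ^\<^sub>m s * u ^\<^sub>m k) * mat_adjoint (v ^\<^sub>m s))"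
        by (simp add: sq_simps)
      \<comment> \<open>Here \<open>v\<close> is moved past \<open>u\<close>, so the commutation
        scalar is \<open>cnj \<zeta>\<close>, the inverse of \<open>\<zeta>\<close>.\<close>
      also have "\<dots> = (cnj \<zeta> ^ (k * s) / of_nat p) \<cdot>\<^sub>m (u ^\<^sub>m k * (v ^\<^sub>m s * mat_adjoint (v ^\<^sub>m s)))"
        unfolding pow_mat_q_commute[OF v_carrier u_carrier v_u_commute]
        by (simp add: sq_simps mult.commute)
      finally show "v ^\<^sub>m s * (((1 / of_nat p) \<cdot>\<^sub>m u ^\<^sub>m k) * mat_adjoint (v ^\<^sub>m s)) =
          (cnj \<zeta> ^ (k * s) / of_nat p) \<cdot>\<^sub>m u ^\<^sub>m k"
        by (simp add: v right_mult_one_mat[of _ d d])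
    qed
    finally show ?thesis .
  qed
  show ?thesis
  proof (rule eq_matI)
    fix i j
    assume "i < dim_row (1\<^sub>m d :: complex mat)" "j < dim_col (1\<^sub>m d :: complex mat)"
    then have ij: "i < d" "j < d" by auto
    have "mat_sum d (\<lambda>s. Q s * mat_adjoint (Q s)) {..<p} $$ (i, j) =
        (\<Sum>s<p. \<Sum>k<p. (cnj \<zeta> ^ (k * s) / of_nat p) * (u ^\<^sub>m k) $$ (i, j))"
      using ij carrier_matD[OF u_carrier] by (simp add: index_mat_sum summand)
    also have "\<dots> = (\<Sum>k<p. \<Sum>s<p. (cnj \<zeta> ^ (k * s) / of_nat p) * (u ^\<^sub>m k) $$ (i, j))"
      by (rule sum.swap)
    also have "\<dots> = (\<Sum>k<p. (\<Sum>s<p. cnj \<zeta> ^ (k * s)) * ((u ^\<^sub>m k) $$ (i, j) / of_nat p))"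
      by (simp add: sum_distrib_right sum_divide_distrib)
    also have "\<dots> = (\<Sum>k<p. if k = 0 then (u ^\<^sub>m k) $$ (i, j) else 0)"
      by (intro sum.cong refl) (use p_pos in \<open>auto simp: sum_root_powers\<close>)
    also have "\<dots> = (1\<^sub>m d :: complex mat) $$ (i, j)"
      using p_pos carrier_matD[OF u_carrier] by simp
    finally show "mat_sum d (\<lambda>s. Q s * mat_adjoint (Q s)) {..<p} $$ (i, j) = 1\<^sub>m d $$ (i, j)" .
  qed (auto simp: mat_sum_def)
qed

text \<open>Since \<open>proj\<close> is a self-adjoint idempotent, its trace is its squared
  Hilbert-Schmidt norm. If this were 0, all \<open>Q s\<close> would vanish, against
  \<open>Q_complete\<close>. Positivity permits the division by the trace below.\<close>

lemma trace_proj_pos: "\<exists>c>0. (\<Sum>r<d. proj $$ (r, r)) = complex_of_real c"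
proof -
  let ?c = "\<Sum>r<d. \<Sum>i<d. (cmod (proj $$ (i, r)))\<^sup>2"
  have "(\<Sum>r<d. (mat_adjoint proj * proj) $$ (r, r)) = complex_of_real ?c"
    by (simp add: index_mult_mat_sum carrier_matD[OF proj_carrier] complex_norm_square mult.commute
        del: index_mult_mat(1) flip: of_real_power)
  then have eq: "(\<Sum>r<d. proj $$ (r, r)) = complex_of_real ?c"
    by (simp add: adjoint_proj proj_idem)
  have "?c \<noteq> 0"
  proof
    assume "?c = 0"
    then have "\<forall>r<d. \<forall>i<d. proj $$ (i, r) = 0"
      by (simp add: sum_nonneg_eq_0_iff sum_nonneg)
    then have "proj = 0\<^sub>m d d"
      using carrier_matD[OF proj_carrier] by (intro eq_matI) auto
    then have "Q s = 0\<^sub>m d d" for s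
      by (simp add: Q_def right_mult_zero_mat[of _ d d])
    then have "(1\<^sub>m d :: complex mat) $$ (0, 0) = 0"
      using d_pos by (simp add: index_mat_sum left_mult_zero_mat[of _ d d] flip: Q_complete)
    then show False
      using d_pos by simp
  qed
  moreover have "?c \<ge> 0"
    by (intro sum_nonneg) simp
  ultimately show ?thesis
    using eq by (intro exI[of _ ?c]) linarith
qed

text \<open>\<open>represents Y A\<close> says that \<open>Y\<close> is the matrix of left multiplication by \<open>A\<close>
  with respect to the system \<open>Q 0, \<dots>, Q (p - 1)\<close>.\<close>

definition represents :: "complex mat \<Rightarrow> complex mat \<Rightarrow> bool" where
  "represents Y A \<longleftrightarrow> Y \<in> carrier_mat p p \<and> A \<in> carrier_mat d d \<and>
     (\<forall>j<p. A * Q j = mat_sum d (\<lambda>i. Y $$ (i, j) \<cdot>\<^sub>m Q i) {..<p})"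

text \<open>The map here is \<open>Y \<mapsto> \<Sum>i j. Y\<^sub>i\<^sub>j Q\<^sub>i Q\<^sub>j\<^sup>*\<close>, a *-homomorphism.\<close>

lemma kraus_map_represents:
  assumes "represents Y A"
  shows "kraus_map p d d (\<lambda>r i s. cnj (Q i $$ (s, r))) Y = A"
proof (rule eq_matI)
  have A: "A \<in> carrier_mat d d"
    and AQ: "\<And>j. j < p \<Longrightarrow> A * Q j = mat_sum d (\<lambda>i. Y $$ (i, j) \<cdot>\<^sub>m Q i) {..<p}"
    using assms by (auto simp: represents_def)
  fix s t
  assume "s < dim_row A" "t < dim_col A"
  then have st: "s < d" "t < d" using A by auto
  \<comment> \<open>The Kraus index \<open>r\<close> is the column index of the \<open>Q i\<close>,
    so summing over it produces the entries of \<open>Q\<^sub>i Q\<^sub>j\<^sup>*\<close>.\<close>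
  have "kraus_map p d d (\<lambda>r i s. cnj (Q i $$ (s, r))) Y $$ (s, t) =
      (\<Sum>r<d. \<Sum>i<p. \<Sum>j<p. Q i $$ (s, r) * Y $$ (i, j) * cnj (Q j $$ (t, r)))"
    using st by (simp add: index_kraus_map)
  also have "\<dots> = (\<Sum>r<d. \<Sum>j<p. \<Sum>i<p. Q i $$ (s, r) * Y $$ (i, j) * cnj (Q j $$ (t, r)))"
    by (intro sum.cong refl sum.swap)
  also have "\<dots> = (\<Sum>r<d. \<Sum>j<p. (A * Q j) $$ (s, r) * cnj (Q j $$ (t, r)))"
    using st by (intro sum.cong refl)
      (simp add: AQ index_mat_sum sum_distrib_right sum_distrib_left mult_ac del: index_mult_mat(1))
  also have "\<dots> = (\<Sum>j<p. \<Sum>r<d. (A * Q j) $$ (s, r) * cnj (Q j $$ (t, r)))"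
    by (rule sum.swap)
  also have "\<dots> = (\<Sum>j<p. (A * Q j * mat_adjoint (Q j)) $$ (s, t))"
    using A st by (intro sum.cong refl)
      (simp add: index_mult_mat_sum[where B = "mat_adjoint X" for X] del: index_mult_mat(1) assoc_mult_mat)
  \<comment> \<open>Factoring out \<open>A\<close> leaves the resolution of the identity.\<close>
  also have "\<dots> = (A * mat_sum d (\<lambda>j. Q j * mat_adjoint (Q j)) {..<p}) $$ (s, t)"
    using A st by (subst mult_mat_sum) (auto simp: sq_simps index_mat_sum)
  also have "\<dots> = A $$ (s, t)"
    using A by (simp add: Q_complete)
  finally show "kraus_map p d d (\<lambda>r i s. cnj (Q i $$ (s, r))) Y $$ (s, t) = A $$ (s, t)" .
qed (use assms in \<open>auto simp: represents_def kraus_map_def\<close>)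

text \<open>The map here sends \<open>A\<close> to the matrix with entries \<open>tr (Q\<^sub>i\<^sup>* A Q\<^sub>j) / tr proj\<close>.\<close>

lemma kraus_map_represents_inverse:
  assumes "represents Y A" and c: "c > 0" "(\<Sum>r<d. proj $$ (r, r)) = complex_of_real c"
  shows "kraus_map d p d (\<lambda>r i s. Q s $$ (i, r) / complex_of_real (sqrt c)) A = Y"
proof (rule eq_matI)
  have A: "A \<in> carrier_mat d d" and Y: "Y \<in> carrier_mat p p"
    and AQ: "\<And>j. j < p \<Longrightarrow> A * Q j = mat_sum d (\<lambda>i. Y $$ (i, j) \<cdot>\<^sub>m Q i) {..<p}"
    using assms by (auto simp: represents_def)
  fix s t
  assume "s < dim_row Y" "t < dim_col Y"
  then have st: "s < p" "t < p" using Y by auto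
  \<comment> \<open>The root occurs in a Kraus operator and in its adjoint, so together they divide
    by the trace \<open>c\<close>.\<close>
  have sqrt: "complex_of_real (sqrt c) * complex_of_real (sqrt c) = complex_of_real c"
    using c(1) by (simp flip: of_real_mult)
  \<comment> \<open>Orthogonality leaves only the term \<open>i = s\<close> in the expansion of
    \<open>A * Q t\<close>.\<close>
  have QAQ: "mat_adjoint (Q s) * (A * Q t) = Y $$ (s, t) \<cdot>\<^sub>m proj"
  proof -
    have "mat_adjoint (Q s) * (A * Q t) =
        mat_sum d (\<lambda>i. Y $$ (i, t) \<cdot>\<^sub>m (mat_adjoint (Q s) * Q i)) {..<p}"
      unfolding AQ[OF st(2)] by (subst mult_mat_sum) (auto simp: sq_simps)
    also have "\<dots> = mat_sum d (\<lambda>i. if i = s then Y $$ (s, t) \<cdot>\<^sub>m proj else 0\<^sub>m d d) {..<p}"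
      using st by (intro mat_sum_cong) (auto simp: adjoint_Q_mult_Q)
    also have "\<dots> = Y $$ (s, t) \<cdot>\<^sub>m proj"
      using st carrier_matD[OF proj_carrier]
      by (intro eq_matI) (auto simp: mat_sum_def if_distrib[of "\<lambda>M. M $$ _"] cong: if_cong)
    finally show ?thesis .
  qed
  have "kraus_map d p d (\<lambda>r i s. Q s $$ (i, r) / complex_of_real (sqrt c)) A $$ (s, t) =
      (\<Sum>r<d. \<Sum>i<d. \<Sum>j<d. cnj (Q s $$ (i, r)) * A $$ (i, j) * Q t $$ (j, r) / complex_of_real c)"
    using st by (simp add: index_kraus_map sqrt)
  \<comment> \<open>The sum over the Kraus index is the trace.\<close>
  also have "\<dots> = (\<Sum>r<d. (mat_adjoint (Q s) * (A * Q t)) $$ (r, r)) / complex_of_real c"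
    using A unfolding sum_divide_distrib
    by (intro sum.cong refl)
      (simp add: index_mult_mat_sum sum_distrib_left sum_divide_distrib mult_ac del: index_mult_mat(1))
  also have "\<dots> = (\<Sum>r<d. Y $$ (s, t) * proj $$ (r, r)) / complex_of_real c"
    by (simp add: QAQ carrier_matD[OF proj_carrier])
  also have "\<dots> = Y $$ (s, t)"
    using c by (simp flip: sum_distrib_left)
  finally show "kraus_map d p d (\<lambda>r i s. Q s $$ (i, r) / complex_of_real (sqrt c)) A $$ (s, t) = Y $$ (s, t)" .
qed (use assms in \<open>auto simp: represents_def kraus_map_def\<close>)

text \<open>Covers all generators at once: the identity and \<open>weyl_u\<close> are diagonal,
  \<open>weyl_v\<close> is a permutation matrix, so at most one term of each column sum
  survives.\<close>

lemma represents_monomial: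
  assumes Y: "Y \<in> carrier_mat p p" and A: "A \<in> carrier_mat d d"
    and f: "\<And>j. j < p \<Longrightarrow> f j < p"
    and AQ: "\<And>j. j < p \<Longrightarrow> A * Q j = c j \<cdot>\<^sub>m Q (f j)"
    and Yij: "\<And>i j. i < p \<Longrightarrow> j < p \<Longrightarrow> Y $$ (i, j) = (if i = f j then c j else 0)"
  shows "represents Y A"
  unfolding represents_def
proof (intro conjI allI impI Y A)
  fix j
  assume j: "j < p"
  show "A * Q j = mat_sum d (\<lambda>i. Y $$ (i, j) \<cdot>\<^sub>m Q i) {..<p}"
  proof (rule eq_matI)
    fix s t
    assume "s < dim_row (mat_sum d (\<lambda>i. Y $$ (i, j) \<cdot>\<^sub>m Q i) {..<p})"
      "t < dim_col (mat_sum d (\<lambda>i. Y $$ (i, j) \<cdot>\<^sub>m Q i) {..<p})"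
    then have st: "s < d" "t < d" by (auto simp: mat_sum_def)
    have "mat_sum d (\<lambda>i. Y $$ (i, j) \<cdot>\<^sub>m Q i) {..<p} $$ (s, t) =
        (\<Sum>i<p. if i = f j then c j * Q i $$ (s, t) else 0)"
      using st j by (simp add: index_mat_sum Yij if_distrib[of "\<lambda>x. x * _"] cong: if_cong)
    also have "\<dots> = (A * Q j) $$ (s, t)"
      using st j f by (simp add: AQ del: index_mult_mat(1))
    finally show "(A * Q j) $$ (s, t) = mat_sum d (\<lambda>i. Y $$ (i, j) \<cdot>\<^sub>m Q i) {..<p} $$ (s, t)" ..
  qed (use A in \<open>auto simp: mat_sum_def\<close>)
qed

lemma represents_generators:
  "represents (1\<^sub>m p) (1\<^sub>m d)" "represents (weyl_u p \<zeta>) u" "represents (weyl_v p) v"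
proof -
  show "represents (1\<^sub>m p) (1\<^sub>m d)"
    by (rule represents_monomial[where f = "\<lambda>j. j" and c = "\<lambda>_. 1"]) (auto simp: sq_simps)
  show "represents (weyl_u p \<zeta>) u"
    by (rule represents_monomial[where f = "\<lambda>j. j" and c = "\<lambda>j. \<zeta> ^ j"])
      (auto simp: weyl_u_def mat_diag_def u_Q)
  show "represents (weyl_v p) v"
  \<comment> \<open>With indices from 0, column \<open>j\<close> has its 1 in row
    \<open>j + 1\<close>, and the last column \<open>p - 1\<close> wraps to row 0, the corner
    entry.\<close>
  proof (rule represents_monomial[where f = "\<lambda>j. Suc j mod p" and c = "\<lambda>_. 1"])
    fix i j
    assume "i < p" "j < p"
    then show "weyl_v p $$ (i, j) = (if i = Suc j mod p then 1 else 0)"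
      by (cases "Suc j = p") (auto simp: weyl_v_def)
  qed (use p_pos in \<open>auto simp: weyl_v_def v_Q\<close>)
qed

section \<open>The two Kraus maps exchange the generators\<close>

lemma complete_order_equivalent_weyl:
  "complete_order_equivalent d [u, v] p [weyl_u p \<zeta>, weyl_v p]"
proof -
  obtain c where c: "c > 0" "(\<Sum>r<d. proj $$ (r, r)) = complex_of_real c"
    using trace_proj_pos by blast
  \<comment> \<open>Each of the three \<open>represents\<close> facts is used twice, once for either
    direction, with \<open>c\<close> the trace of \<open>proj\<close>.\<close>
  note to_weyl = kraus_map_represents_inverse[OF _ c]
  show ?thesis
  proof (rule complete_order_equivalent_kraus)
    show "set [u, v] \<subseteq> carrier_mat d d" "set [weyl_u p \<zeta>, weyl_v p] \<subseteq> carrier_mat p p"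
      by (auto simp: weyl_u_def weyl_v_def mat_diag_def)
    show "kraus_map d p d (\<lambda>r i s. Q s $$ (i, r) / complex_of_real (sqrt c)) (1\<^sub>m d) = 1\<^sub>m p"
      by (rule to_weyl[OF represents_generators(1)])
    show "kraus_map p d d (\<lambda>r i s. cnj (Q i $$ (s, r))) (1\<^sub>m p) = 1\<^sub>m d"
      by (rule kraus_map_represents[OF represents_generators(1)])
  next
    fix k
    assume "k < length [u, v]"
    then have k: "k = 0 \<or> k = 1" by auto
    show "kraus_map d p d (\<lambda>r i s. Q s $$ (i, r) / complex_of_real (sqrt c)) ([u, v] ! k) =
        [weyl_u p \<zeta>, weyl_v p] ! k"
      using k to_weyl represents_generators by auto
    show "kraus_map p d d (\<lambda>r i s. cnj (Q i $$ (s, r))) ([weyl_u p \<zeta>, weyl_v p] ! k) = [u, v] ! k"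
      using k kraus_map_represents represents_generators by auto
  qed simp
qed

end

theorem theorem2p7:
  fixes p d :: nat and \<zeta> :: complex and u v :: "complex mat"
  assumes "2 \<le> p" and "primitive_root_of_unity p \<zeta>"
    and "1 \<le> d"
    and "unitary_matrix d u" and "unitary_matrix d v"
    and "u ^\<^sub>m p = 1\<^sub>m d" and "v ^\<^sub>m p = 1\<^sub>m d"
    and "u * v = \<zeta> \<cdot>\<^sub>m (v * u)"
  shows "complete_order_equivalent d [u, v] p [weyl_u p \<zeta>, weyl_v p]"
proof -
  interpret weyl_pair p d \<zeta> u v
    by unfold_locales fact+
  show ?thesis
    by (rule complete_order_equivalent_weyl)
qed

end
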